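(* Let $N_G\geq 1$ be an integer. The group-connected RIS with group size $N_G$ is planar-connected if and only if $N_G\leq 4$. Moreover, the fully-connected RIS is not planar-connected.
   Context: An $N$-element beyond-diagonal reconfigurable intelligent surface (BD-RIS) is represented by a finite simple undirected graph $\mathcal{G}=\mathcal{G}_N=(\mathcal{V},\mathcal{E})$ with vertex set $\mathcal{V}=\{v_1,\ldots,v_N\}$ (one vertex per RIS element), where $v_n$ and $v_m$ ($n\neq m$) are joined by an edge if and only if a tunable admittance component interconnects elements $n$ and $m$. A BD-RIS architecture is a rule assigning such a graph $\mathcal{G}_N$ to each admissible number of elements $N$. A graph is planar if it can be drawn in the plane with no edges crossing. A BD-RIS architecture is planar-connected if its associated graph $\mathcal{G}_N$ is planar for any (admissible) number of RIS elements $N$. The group-connected RIS with group size $N_G$ is defined for every positive multiple $N$ of $N_G$: the $N$ elements are partitioned into $N/N_G$ groups of size $N_G$, and two distinct elements are interconnected if and only if they belong to the same group; hence $\mathcal{G}_N$ is a disjoint union of $N/N_G$ copies of the complete graph $K_{N_G}$. The fully-connected RIS is defined for every $N\geq 1$, with all pairs of distinct elements interconnected, so that $\mathcal{G}_N=K_N$ is the complete graph on $N$ vertices. *)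

theory Defs
  imports "HOL-Analysis.Analysis"
begin

record 'v ugraph =
  verts :: "'v set"
  edges :: "'v set set"

definition simple_graph :: "'v ugraph \<Rightarrow> bool" where
  "simple_graph G \<longleftrightarrow> finite (verts G) \<and> (\<forall>e\<in>edges G. e \<subseteq> verts G \<and> card e = 2)"

definition complete_graph :: "'v set \<Rightarrow> 'v ugraph" where
  "complete_graph V = \<lparr>verts = V, edges = {{u, v} | u v. u \<in> V \<and> v \<in> V \<and> u \<noteq> v}\<rparr>"

text \<open>The plane is \<^typ>\<open>complex\<close>, as for the Jordan curve theorem in the library.
  Recall that an \<^const>\<open>arc\<close> is an injective path, so edges do not cross themselves either.\<close>

definition plane_drawing :: "'v ugraph \<Rightarrow> ('v \<Rightarrow> complex) \<Rightarrow> ('v set \<Rightarrow> real \<Rightarrow> complex) \<Rightarrow> bool" where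
  "plane_drawing G p \<gamma> \<longleftrightarrow>
     inj_on p (verts G) \<and>
     (\<forall>e\<in>edges G. arc (\<gamma> e) \<and> {pathstart (\<gamma> e), pathfinish (\<gamma> e)} = p ` e \<and>
        path_image (\<gamma> e) \<inter> p ` verts G = p ` e) \<and>
     (\<forall>e\<in>edges G. \<forall>f\<in>edges G. e \<noteq> f \<longrightarrow>
        path_image (\<gamma> e) \<inter> path_image (\<gamma> f) \<subseteq> p ` (e \<inter> f))"

definition planar :: "'v ugraph \<Rightarrow> bool" where
  "planar G \<longleftrightarrow> (\<exists>p \<gamma>. plane_drawing G p \<gamma>)"

text \<open>The domain of the partial function is the set of admissible numbers of elements.\<close>

type_synonym architecture = "nat \<Rightarrow> nat ugraph option"

definition bd_ris_architecture :: "architecture \<Rightarrow> bool" where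
  "bd_ris_architecture A \<longleftrightarrow> (\<forall>N G. A N = Some G \<longrightarrow> simple_graph G \<and> verts G = {1..N})"

definition planar_connected :: "architecture \<Rightarrow> bool" where
  "planar_connected A \<longleftrightarrow> (\<forall>N G. A N = Some G \<longrightarrow> planar G)"

definition grouping :: "nat \<Rightarrow> (nat \<Rightarrow> nat set set) \<Rightarrow> bool" where
  "grouping NG groups \<longleftrightarrow>
     (\<forall>N>0. NG dvd N \<longrightarrow> partition_on {1..N} (groups N) \<and> (\<forall>B\<in>groups N. card B = NG))"

definition group_connected :: "nat \<Rightarrow> (nat \<Rightarrow> nat set set) \<Rightarrow> architecture" where
  "group_connected NG groups N =
     (if N > 0 \<and> NG dvd N
      then Some \<lparr>verts = {1..N},
                 edges = {{u, v} | u v. u \<noteq> v \<and> (\<exists>B\<in>groups N. u \<in> B \<and> v \<in> B)}\<rparr>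
      else None)"

definition fully_connected :: architecture where
  "fully_connected N = (if N \<ge> 1 then Some (complete_graph {1..N}) else None)"

lemma bd_ris_architecture_group_connected:
  assumes "grouping NG groups"
  shows "bd_ris_architecture (group_connected NG groups)"
  unfolding bd_ris_architecture_def
proof (intro allI impI)
  fix N G
  assume "group_connected NG groups N = Some G"
  then have N: "N > 0" "NG dvd N"
    and G: "G = \<lparr>verts = {1..N}, edges = {{u, v} | u v. u \<noteq> v \<and> (\<exists>B\<in>groups N. u \<in> B \<and> v \<in> B)}\<rparr>"
    by (auto simp: group_connected_def split: if_splits)
  have P: "\<Union>(groups N) = {1..N}"
    using assms N by (auto simp: grouping_def partition_on_def)
  have "e \<subseteq> {1..N} \<and> card e = 2" if "e \<in> edges G" for e
  proof -
    obtain u v B where "e = {u, v}" "u \<noteq> v" "B \<in> groups N" "u \<in> B" "v \<in> B"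
      using \<open>e \<in> edges G\<close> unfolding G by auto
    moreover from this have "u \<in> \<Union>(groups N)" "v \<in> \<Union>(groups N)"
      by blast+
    ultimately show ?thesis
      unfolding P by auto
  qed
  then show "simple_graph G \<and> verts G = {1..N}"
    by (simp add: simple_graph_def G)
qed

lemma bd_ris_architecture_fully_connected: "bd_ris_architecture fully_connected"
  by (auto simp: bd_ris_architecture_def fully_connected_def complete_graph_def simple_graph_def
           split: if_splits)

lemma grouping_exists:
  assumes "NG \<ge> 1"
  shows "\<exists>groups. grouping NG groups"
proof -
  define B where "B i = {n. 1 \<le> n \<and> (n - 1) div NG = i}" for i
  have B: "B i = {i * NG + 1..i * NG + NG}" for i
  proof (intro set_eqI iffI)
    fix n assume "n \<in> B i"
    then have "1 \<le> n" and i: "(n - 1) div NG = i" by (auto simp: B_def)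
    moreover have "i * NG + (n - 1) mod NG = n - 1"
      unfolding i[symmetric] by (rule div_mult_mod_eq)
    moreover have "(n - 1) mod NG < NG" using assms by simp
    ultimately have "i * NG + 1 \<le> n" "n \<le> i * NG + NG" by linarith+
    then show "n \<in> {i * NG + 1..i * NG + NG}" by simp
  next
    fix n assume n: "n \<in> {i * NG + 1..i * NG + NG}"
    then have "NG * i \<le> n - 1" "n - 1 < NG * Suc i"
      by (simp_all add: mult.commute, linarith+)
    then have "(n - 1) div NG = i"
      by (rule div_nat_eqI)
    then show "n \<in> B i" using n by (auto simp: B_def)
  qed
  have "partition_on {1..N} (B ` {..<N div NG}) \<and> (\<forall>b\<in>B ` {..<N div NG}. card b = NG)"
    if "NG dvd N" for N
  proof -
    have "\<Union>(B ` {..<N div NG}) = {1..N}"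
    proof (intro set_eqI iffI)
      fix n assume "n \<in> \<Union>(B ` {..<N div NG})"
      then obtain i where i: "i < N div NG" "n \<in> B i" by auto
      then have "Suc i * NG \<le> N"
        using \<open>NG dvd N\<close> assms by (metis Suc_leI dvd_div_mult_self mult_le_mono1)
      then show "n \<in> {1..N}" using i(2) unfolding B by auto
    next
      fix n assume "n \<in> {1..N}"
      then have "n - 1 < N div NG * NG" and "1 \<le> n"
        using \<open>NG dvd N\<close> by auto
      then have "(n - 1) div NG < N div NG" "1 \<le> n"
        by (simp_all add: less_mult_imp_div_less)
      then show "n \<in> \<Union>(B ` {..<N div NG})" by (auto simp: B_def)
    qed
    moreover have "{} \<notin> B ` {..<N div NG}" and "\<forall>b\<in>B ` {..<N div NG}. card b = NG"
      using assms unfolding B by auto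
    moreover have "disjoint (B ` {..<N div NG})"
      by (auto simp: disjoint_def B_def)
    ultimately show ?thesis by (auto simp: partition_on_def)
  qed
  then have "grouping NG (\<lambda>N. B ` {..<N div NG})"
    by (auto simp: grouping_def)
  then show ?thesis by blast
qed

end

theory Submission
  imports Defs
begin

text \<open>
  A drawing of \<open>K\<^sub>5\<close> is excluded by the Jordan curve theorem and Janiszewski's theorem. If a point is
  outside each of the three triangles at a vertex \<open>d\<close> of a drawn \<open>K\<^sub>4\<close> on \<open>a, b, c, d\<close>, then by
  Janiszewski it is outside their union, hence outside the triangle \<open>abc\<close>. So the inside of \<open>abc\<close> is
  covered, up to edges, by the insides of \<open>abd\<close>, \<open>acd\<close> and \<open>bcd\<close>. In a drawn \<open>K\<^sub>5\<close> the two vertices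
  off a triangle lie on the same side of it, being joined by an edge. If \<open>d\<close> and \<open>e\<close> were inside
  \<open>abc\<close>, then \<open>e\<close> would be inside \<open>abd\<close>, say, and therefore also \<open>c\<close>, which is impossible. So no vertex
  is inside any triangle; then the inside of \<open>abc\<close> meets, and hence equals, the inside of another triangle,
  although their frontiers differ.

  Conversely, copies of a straight-line drawing of \<open>K\<^sub>4\<close> are placed side by side, one for each group.
\<close>

section \<open>Nonplanarity of the complete graph on five vertices\<close>

text \<open>Janiszewski's theorem is about joining two points. The second point is a far one,
  \<open>y\<close>: since the outside of a bounded planar set is connected, \<open>x\<close> is
  joined to \<open>y\<close> off \<open>S\<close> and off \<open>T\<close>, hence off the
  union.\<close>

lemma outside_Un_connected_Int:
  fixes S T :: "complex set"
  assumes "compact S" "compact T" "connected (S \<inter> T)" "x \<in> outside S" "x \<in> outside T"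
  shows "x \<in> outside (S \<union> T)"
proof -
  have "bounded (S \<union> T)"
    using assms by (simp add: compact_imp_bounded)
  then obtain r where "0 < r" and r: "S \<union> T \<subseteq> ball 0 r"
    using bounded_subset_ballD by blast
  \<comment> \<open>This point has norm \<open>r\<close>, so it is off the ball and therefore
    outside every subset of the ball.\<close>
  define y :: complex where "y = of_real r"
  have y: "y \<in> - ball 0 r"
    using \<open>0 < r\<close> by (simp add: y_def)
  have out: "y \<in> outside A" if "A \<subseteq> ball 0 r" for A
    using outside_subset_convex[OF convex_ball that] y by blast
  have comp: "connected_component (- A) x y" if "compact A" "A \<subseteq> ball 0 r" "x \<in> outside A" for A
  proof -
    have "connected (outside A)"
      using that by (simp add: connected_outside compact_imp_bounded)
    moreover have "outside A \<subseteq> - A"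
      using outside_no_overlap[of A] by blast
    ultimately show ?thesis
      unfolding connected_component_def using out[OF that(2)] that(3) by blast
  qed
  have "connected_component (- (S \<union> T)) x y"
    using assms r comp compact_imp_closed by (intro Janiszewski) auto
  then show ?thesis
    using out[OF r] outside_same_component connected_component_sym by blast
qed

lemma connected_subset_inside:
  assumes "connected C" "C \<inter> S = {}" "C \<inter> inside S \<noteq> {}"
  shows "C \<subseteq> inside S"
proof
  fix y assume "y \<in> C"
  obtain x where "x \<in> C" "x \<in> inside S"
    using assms by blast
  then have "connected_component (- S) x y"
    unfolding connected_component_def using assms \<open>y \<in> C\<close> by blast
  then show "y \<in> inside S"
    using \<open>x \<in> inside S\<close> by (rule inside_same_component)
qed

text \<open>By injectivity the rest of the arc is the image of \<open>{0<..1}\<close>. This is for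
  an edge that leaves a triangle at a corner: it stays connected when the corner is dropped.\<close>

lemma arc_minus_pathstart_connected:
  assumes "arc g"
  shows "connected (path_image g - {pathstart g})"
proof -
  have "{0<..1} = {0..1} - {0::real}"
    by auto
  then have "g ` {0<..1} = path_image g - {pathstart g}"
    using assms inj_on_image_set_diff[of g "{0..1}" "{0..1}" "{0}"]
    by (simp add: path_image_def pathstart_def arc_def)
  moreover have "connected (g ` {0<..1})"
    using assms by (intro connected_continuous_image)
      (auto simp: arc_def path_def intro: continuous_on_subset)
  ultimately show ?thesis by simp
qed

text \<open>Edges are kept only as point sets \<open>L u v\<close>, so direction matters in
  \<open>edge_arc\<close> alone, which supplies an arc starting at either end. Injectivity of
  \<open>p\<close> on \<open>K\<close> is implied, as the ends of an arc differ.\<close>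

locale drawn_clique =
  fixes K :: "'v set" and p :: "'v \<Rightarrow> complex" and L :: "'v \<Rightarrow> 'v \<Rightarrow> complex set"
  assumes edge_arc: "\<lbrakk>u \<in> K; v \<in> K; u \<noteq> v\<rbrakk> \<Longrightarrow>
      \<exists>g. arc g \<and> pathstart g = p u \<and> pathfinish g = p v \<and> path_image g = L u v"
    and edge_commute: "L u v = L v u"
    and edge_vertex: "\<lbrakk>u \<in> K; v \<in> K; w \<in> K; distinct [u, v, w]\<rbrakk> \<Longrightarrow> p w \<notin> L u v"
    and edges_adjacent: "\<lbrakk>u \<in> K; v \<in> K; w \<in> K; distinct [u, v, w]\<rbrakk> \<Longrightarrow> L u v \<inter> L u w = {p u}"
    and edges_opposite: "\<lbrakk>u \<in> K; v \<in> K; w \<in> K; x \<in> K; distinct [u, v, w, x]\<rbrakk> \<Longrightarrow>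
      L u v \<inter> L w x = {}"
begin

section \<open>Triangles of a drawn clique as Jordan curves\<close>

definition triangle :: "'v \<Rightarrow> 'v \<Rightarrow> 'v \<Rightarrow> complex set" where
  "triangle a b c = L a b \<union> L b c \<union> L a c"

lemma triangle_commute: "triangle b a c = triangle a b c" "triangle a c b = triangle a b c"
  unfolding triangle_def edge_commute[of b a] edge_commute[of c b] by (simp_all only: Un_ac)

lemma endpoints:
  assumes "u \<in> K" "v \<in> K" "u \<noteq> v"
  shows "p u \<in> L u v" "p v \<in> L u v"
  using edge_arc[OF assms] pathstart_in_path_image pathfinish_in_path_image by metis+

lemma compact_edge: "\<lbrakk>u \<in> K; v \<in> K; u \<noteq> v\<rbrakk> \<Longrightarrow> compact (L u v)"
  using edge_arc compact_path_image arc_imp_path by metis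

lemma connected_edge: "\<lbrakk>u \<in> K; v \<in> K; u \<noteq> v\<rbrakk> \<Longrightarrow> connected (L u v)"
  using edge_arc connected_path_image arc_imp_path by metis

lemma connected_edge_minus: "\<lbrakk>u \<in> K; v \<in> K; u \<noteq> v\<rbrakk> \<Longrightarrow> connected (L u v - {p u})"
  using edge_arc arc_minus_pathstart_connected by metis

lemma compact_triangle:
  "\<lbrakk>a \<in> K; b \<in> K; c \<in> K; distinct [a, b, c]\<rbrakk> \<Longrightarrow> compact (triangle a b c)"
  unfolding triangle_def by (intro compact_Un compact_edge) auto

lemma vertex_notin_triangle:
  "\<lbrakk>a \<in> K; b \<in> K; c \<in> K; d \<in> K; distinct [a, b, c, d]\<rbrakk> \<Longrightarrow> p d \<notin> triangle a b c"
  unfolding triangle_def using edge_vertex by auto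

text \<open>Two sides meet only in their common corner, so joining the three arcs around the
  triangle gives a simple closed path.\<close>

lemma triangle_Jordan:
  assumes "a \<in> K" "b \<in> K" "c \<in> K" "distinct [a, b, c]"
  obtains g where "simple_path g" "pathfinish g = pathstart g" "path_image g = triangle a b c"
proof -
  obtain g where g: "arc g" "pathstart g = p a" "pathfinish g = p b" "path_image g = L a b"
    using edge_arc[of a b] assms by auto
  obtain h where h: "arc h" "pathstart h = p b" "pathfinish h = p c" "path_image h = L b c"
    using edge_arc[of b c] assms by auto
  obtain k where k: "arc k" "pathstart k = p c" "pathfinish k = p a" "path_image k = L c a"
    using edge_arc[of c a] assms by auto
  have hk: "L b c \<inter> L c a = {p c}" and gh: "L a b \<inter> L b c = {p b}" and gk: "L a b \<inter> L c a = {p a}"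
    using edges_adjacent[of c b a] edges_adjacent[of b a c] edges_adjacent[of a b c] assms
      edge_commute by auto
  have "arc (h +++ k)"
    using g h k hk by (intro arc_join) auto
  then have "simple_path (g +++ h +++ k)"
    using g h k gh gk by (intro simple_path_join_loop) (auto simp: path_image_join)
  moreover have "path_image (g +++ h +++ k) = triangle a b c"
    using g h k edge_commute by (auto simp: path_image_join triangle_def)
  ultimately show ?thesis
    using that k g by (metis pathfinish_join pathstart_join)
qed

lemma triangle_inside_outside:
  assumes "a \<in> K" "b \<in> K" "c \<in> K" "distinct [a, b, c]"
  shows "inside (triangle a b c) \<noteq> {}" "open (inside (triangle a b c))"
    "connected (inside (triangle a b c))" "connected (outside (triangle a b c))"
    "frontier (inside (triangle a b c)) = triangle a b c"
    "frontier (outside (triangle a b c)) = triangle a b c"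
    "\<not> bounded (outside (triangle a b c))"
  using triangle_Jordan[OF assms] Jordan_inside_outside by metis+

text \<open>Two of the three triangles at \<open>d\<close> meet in an edge, and their union meets the third in a path,
  so Janiszewski's theorem applies twice to a point outside all three.\<close>

lemma inside_triangle_cover:
  assumes K: "a \<in> K" "b \<in> K" "c \<in> K" "d \<in> K" "distinct [a, b, c, d]"
    and x: "x \<in> inside (triangle a b c)" "x \<notin> L a d" "x \<notin> L b d" "x \<notin> L c d"
  shows "x \<in> inside (triangle a b d) \<union> inside (triangle a c d) \<union> inside (triangle b c d)"
proof (rule ccontr)
  assume "\<not> ?thesis"
  moreover have "x \<notin> triangle a b c"
    using x inside_no_overlap by blast
  then have "x \<notin> triangle a b d" "x \<notin> triangle a c d" "x \<notin> triangle b c d"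
    using x(2-) by (auto simp: triangle_def)
  ultimately have out: "x \<in> outside (triangle a b d)" "x \<in> outside (triangle a c d)"
      "x \<in> outside (triangle b c d)"
    by (simp_all add: outside_inside)
  have opp: "L a b \<inter> L c d = {}" "L a c \<inter> L b d = {}" "L a d \<inter> L b c = {}"
    using edges_opposite[of a b c d] edges_opposite[of a c b d] edges_opposite[of a d b c] K
    by auto
  have adj: "L a b \<inter> L a c = {p a}" "L a b \<inter> L b c = {p b}" "L a c \<inter> L b c = {p c}"
      "L b d \<inter> L c d = {p d}"
    using edges_adjacent[of a b c] edges_adjacent[of b a c] edges_adjacent[of c a b]
      edges_adjacent[of d b c] K
      edge_commute[of b a] edge_commute[of c a] edge_commute[of c b] edge_commute[of d b]
      edge_commute[of d c] by auto
  have pts: "p a \<in> L a d" "p b \<in> L b d" "p c \<in> L c d" "p d \<in> L b d" "p d \<in> L c d" "p d \<in> L a d"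
    using endpoints[of a d] endpoints[of b d] endpoints[of c d] K by simp_all
  \<comment> \<open>Opposite edges contribute nothing, and the adjacent pairs contribute only
    \<open>p a\<close> and \<open>p d\<close>, which already lie on \<open>L a d\<close>.\<close>
  have "triangle a b d \<inter> triangle a c d =
      L a d \<union> (L a b \<inter> L a c) \<union> (L a b \<inter> L c d) \<union> (L a c \<inter> L b d) \<union> (L b d \<inter> L c d)"
    unfolding triangle_def by blast
  then have "triangle a b d \<inter> triangle a c d = L a d"
    using pts by (simp add: opp adj insert_absorb)
  then have "x \<in> outside (triangle a b d \<union> triangle a c d)"
    using out K by (intro outside_Un_connected_Int compact_triangle) (auto intro: connected_edge)
  moreover have "(triangle a b d \<union> triangle a c d) \<inter> triangle b c d =
      L b d \<union> L c d \<union> (L a b \<inter> L b c) \<union> (L a c \<inter> L b c) \<union> (L a d \<inter> L b c)"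
    unfolding triangle_def by blast
  then have "(triangle a b d \<union> triangle a c d) \<inter> triangle b c d = L b d \<union> L c d"
    using pts by (simp add: opp adj insert_absorb)
  moreover have "connected (L b d \<union> L c d)"
    using K pts by (intro connected_Un connected_edge) auto
  ultimately have "x \<in> outside (triangle a b d \<union> triangle a c d \<union> triangle b c d)"
    using out K
    by (intro outside_Un_connected_Int[where S = "triangle a b d \<union> triangle a c d"]
        compact_Un compact_triangle) auto
  moreover have "triangle a b c \<subseteq> triangle a b d \<union> triangle a c d \<union> triangle b c d"
    unfolding triangle_def by blast
  ultimately have "x \<in> outside (triangle a b c)"
    using outside_mono by blast
  then show False
    using x inside_Int_outside by blast
qed

lemma edge_minus_Int_triangle:
  assumes K: "a \<in> K" "b \<in> K" "c \<in> K" "d \<in> K" "distinct [a, b, c, d]"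
  shows "(L a d - {p a}) \<inter> triangle a b c = {}"
  using edges_adjacent[of a b d] edges_adjacent[of a c d] edges_opposite[of a d b c] K
  by (auto simp: triangle_def)

text \<open>The edge touches the triangle at \<open>p a\<close> only; without that point it is
  connected and cannot cross from one side to the other.\<close>

lemma edge_minus_subset_inside:
  assumes K: "a \<in> K" "b \<in> K" "c \<in> K" "d \<in> K" "distinct [a, b, c, d]"
    and "L a d \<inter> inside (triangle a b c) \<noteq> {}"
  shows "L a d - {p a} \<subseteq> inside (triangle a b c)"
proof (rule connected_subset_inside)
  have "p a \<in> triangle a b c"
    using endpoints K by (auto simp: triangle_def)
  then have "p a \<notin> inside (triangle a b c)"
    using inside_no_overlap by blast
  then show "(L a d - {p a}) \<inter> inside (triangle a b c) \<noteq> {}"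
    using assms by blast
qed (use K connected_edge_minus edge_minus_Int_triangle in auto)

text \<open>All three sides of the triangle are opposite to the edge \<open>L d e\<close>, which
  therefore never crosses it.\<close>

lemma vertices_same_side:
  assumes K: "a \<in> K" "b \<in> K" "c \<in> K" "d \<in> K" "e \<in> K" "distinct [a, b, c, d, e]"
    and "p d \<in> inside (triangle a b c)"
  shows "p e \<in> inside (triangle a b c)"
proof -
  have "L d e \<inter> triangle a b c = {}"
    using edges_opposite[of d e a b] edges_opposite[of d e b c] edges_opposite[of d e a c] K
    by (auto simp: triangle_def)
  then have "L d e \<subseteq> inside (triangle a b c)"
    using K assms(7) endpoints[of d e] by (intro connected_subset_inside connected_edge) auto
  then show ?thesis
    using endpoints[of d e] K by auto
qed

text \<open>If \<open>d\<close> is inside \<open>abc\<close>, then \<open>outside (abc)\<close> lies outside \<open>abd\<close>, and \<open>c\<close> is a limit of it.\<close>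

lemma not_both_inside:
  assumes K: "a \<in> K" "b \<in> K" "c \<in> K" "d \<in> K" "distinct [a, b, c, d]"
    and d: "p d \<in> inside (triangle a b c)"
  shows "p c \<notin> inside (triangle a b d)"
proof
  assume c: "p c \<in> inside (triangle a b d)"
  \<comment> \<open>Up to their ends on \<open>L a b\<close>, the edges from \<open>d\<close> to
    \<open>a\<close> and \<open>b\<close> run inside \<open>abc\<close>, so \<open>abd\<close> does
    not reach the outside of \<open>abc\<close>.\<close>
  have "L a d - {p a} \<subseteq> inside (triangle a b c)" "L b d - {p b} \<subseteq> inside (triangle b a c)"
    using K d endpoints[of a d] endpoints[of b d] triangle_commute(1)[of a b c]
    by (intro edge_minus_subset_inside; auto)+
  moreover have "p a \<in> L a b" "p b \<in> L a b"
    using endpoints K by auto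
  ultimately have "triangle a b d \<subseteq> inside (triangle a b c) \<union> triangle a b c"
    using triangle_commute(1)[of a b c] by (auto simp: triangle_def)
  then have disj: "outside (triangle a b c) \<inter> triangle a b d = {}"
    using inside_Int_outside outside_no_overlap by blast
  have "p c \<in> triangle a b c"
    using endpoints K by (auto simp: triangle_def)
  then have "p c \<in> closure (outside (triangle a b c))"
    using triangle_inside_outside(6)[of a b c] K by (auto simp: frontier_def)
  moreover have "open (inside (triangle a b d))"
    using triangle_inside_outside(2)[of a b d] K by auto
  ultimately have "outside (triangle a b c) \<inter> inside (triangle a b d) \<noteq> {}"
    using c by (meson closure_iff_nhds_not_empty disjoint_iff subset_refl)
  \<comment> \<open>A connected set that meets the inside of \<open>abd\<close> but not
    \<open>abd\<close> itself is contained in that inside; here an unbounded set would be contained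
    in a bounded one.\<close>
  then have "outside (triangle a b c) \<subseteq> inside (triangle a b d)"
    using disj triangle_inside_outside(4)[of a b c] K by (intro connected_subset_inside) auto
  moreover have "bounded (inside (triangle a b d))"
    using bounded_inside compact_imp_bounded compact_triangle[of a b d] K by auto
  ultimately show False
    using triangle_inside_outside(7)[of a b c] K bounded_subset by auto
qed

section \<open>Contradiction from five vertices\<close>

lemma vertex_notin_inside:
  assumes K: "a \<in> K" "b \<in> K" "c \<in> K" "d \<in> K" "e \<in> K" "distinct [a, b, c, d, e]"
  shows "p d \<notin> inside (triangle a b c)"
proof
  assume d: "p d \<in> inside (triangle a b c)"
  then have "p e \<in> inside (triangle a b c)"
    using K vertices_same_side by blast
  then have "p e \<in> inside (triangle a b d) \<union> inside (triangle a c d) \<union> inside (triangle b c d)"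
    using K edge_vertex by (intro inside_triangle_cover) auto
  \<comment> \<open>Here \<open>z\<close> is the corner of \<open>abc\<close> left out of the
    triangle at \<open>d\<close>. If \<open>e\<close> were inside \<open>xyd\<close>, so would be
    \<open>z\<close>, against \<open>not_both_inside\<close>.\<close>
  moreover have "p e \<notin> inside (triangle x y d)"
    if "x \<in> K" "y \<in> K" "z \<in> K" "distinct [x, y, z, d, e]" "triangle x y z = triangle a b c" for x y z
    using vertices_same_side[of x y d e z] not_both_inside[of x y z d] that d K by auto
  from this[of a b c] this[of a c b] this[of b c a]
  have "p e \<notin> inside (triangle a b d)" "p e \<notin> inside (triangle a c d)" "p e \<notin> inside (triangle b c d)"
    using K triangle_commute by auto
  ultimately show False
    by blast
qed

text \<open>An edge that enters the inside has to end there, which would put \<open>p d\<close>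
  inside.\<close>

lemma edge_Int_inside:
  assumes K: "a \<in> K" "b \<in> K" "c \<in> K" "d \<in> K" "e \<in> K" "distinct [a, b, c, d, e]"
  shows "L a d \<inter> inside (triangle a b c) = {}"
proof (rule ccontr)
  assume "\<not> ?thesis"
  then have "L a d - {p a} \<subseteq> inside (triangle a b c)"
    using K by (intro edge_minus_subset_inside) auto
  moreover have "p d \<in> L a d - {p a}"
    using K endpoints[of a d] endpoints[of a b] edge_vertex[of a b d] by auto
  ultimately show False
    using vertex_notin_inside K by blast
qed

lemma triangle_Int_inside:
  assumes K: "a \<in> K" "b \<in> K" "c \<in> K" "d \<in> K" "e \<in> K" "distinct [a, b, c, d, e]"
  shows "triangle a b d \<inter> inside (triangle a b c) = {}"
proof -
  have "L a d \<inter> inside (triangle a b c) = {}" "L b d \<inter> inside (triangle a b c) = {}"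
    using edge_Int_inside[of a b c d e] edge_Int_inside[of b a c d e] K triangle_commute(1)[of a b c]
    by auto
  moreover have "L a b \<subseteq> triangle a b c"
    by (auto simp: triangle_def)
  ultimately show ?thesis
    using inside_no_overlap[of "triangle a b c"] unfolding triangle_def[of a b d] by blast
qed

text \<open>By \<open>triangle_Int_inside\<close> neither triangle enters the inside of the other,
  so overlapping insides, being connected, contain each other. Their frontiers would then agree, but
  \<open>p c\<close> lies on \<open>abc\<close> and not on \<open>abd\<close>.\<close>

lemma insides_disjoint:
  assumes K: "a \<in> K" "b \<in> K" "c \<in> K" "d \<in> K" "e \<in> K" "distinct [a, b, c, d, e]"
  shows "inside (triangle a b c) \<inter> inside (triangle a b d) = {}"
proof (rule ccontr)
  assume meet: "\<not> ?thesis"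
  have "inside (triangle a b c) \<subseteq> inside (triangle a b d)"
    using K meet triangle_Int_inside[of a b c d e] triangle_inside_outside(3)[of a b c]
    by (intro connected_subset_inside) auto
  moreover have "inside (triangle a b d) \<subseteq> inside (triangle a b c)"
    using K meet triangle_Int_inside[of a b d c e] triangle_inside_outside(3)[of a b d]
    by (intro connected_subset_inside) auto
  ultimately have "inside (triangle a b c) = inside (triangle a b d)"
    by simp
  moreover have "frontier (inside (triangle a b c)) = triangle a b c"
      "frontier (inside (triangle a b d)) = triangle a b d"
    using triangle_inside_outside(5)[of a b c] triangle_inside_outside(5)[of a b d] K by auto
  ultimately have "triangle a b c = triangle a b d"
    by metis
  moreover have "p c \<in> triangle a b c"
    using endpoints K by (auto simp: triangle_def)
  ultimately show False
    using vertex_notin_triangle[of a b d c] K by auto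
qed

lemma no_five_vertices:
  assumes K: "a \<in> K" "b \<in> K" "c \<in> K" "d \<in> K" "e \<in> K" "distinct [a, b, c, d, e]"
  shows False
proof -
  obtain x where x: "x \<in> inside (triangle a b c)"
    using triangle_inside_outside(1)[of a b c] K by auto
  have "x \<notin> L a d" "x \<notin> L b d" "x \<notin> L c d"
    using x K edge_Int_inside[of a b c d e] edge_Int_inside[of b a c d e]
      edge_Int_inside[of c a b d e] triangle_commute by auto
  then have "x \<in> inside (triangle a b d) \<union> inside (triangle a c d) \<union> inside (triangle b c d)"
    using x K by (intro inside_triangle_cover) auto
  moreover have "x \<notin> inside (triangle a b d)" "x \<notin> inside (triangle a c d)"
      "x \<notin> inside (triangle b c d)"
    using x K insides_disjoint[of a b c d e] insides_disjoint[of a c b d e]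
      insides_disjoint[of b c a d e] triangle_commute by auto
  ultimately show False
    by blast
qed

end

text \<open>The clique may sit in any graph, so that both a group and a complete graph are covered.
  The drawing restricted to \<open>K\<close> satisfies \<open>drawn_clique\<close>, where five
  vertices are contradictory.\<close>

lemma not_planar_if_clique5:
  assumes K: "K \<subseteq> verts G" "card K \<ge> 5"
    and clique: "\<And>u v. \<lbrakk>u \<in> K; v \<in> K; u \<noteq> v\<rbrakk> \<Longrightarrow> {u, v} \<in> edges G"
  shows "\<not> planar G"
proof
  assume "planar G"
  then obtain p \<gamma> where "plane_drawing G p \<gamma>"
    by (auto simp: planar_def)
  then have inj: "inj_on p (verts G)"
    and edge: "\<And>e. e \<in> edges G \<Longrightarrow> arc (\<gamma> e) \<and> {pathstart (\<gamma> e), pathfinish (\<gamma> e)} = p ` e \<and>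
        path_image (\<gamma> e) \<inter> p ` verts G = p ` e"
    and cross: "\<And>e f. \<lbrakk>e \<in> edges G; f \<in> edges G; e \<noteq> f\<rbrakk> \<Longrightarrow>
        path_image (\<gamma> e) \<inter> path_image (\<gamma> f) \<subseteq> p ` (e \<inter> f)"
    by (auto simp: plane_drawing_def)
  define L where "L u v = path_image (\<gamma> {u, v})" for u v
  have ends: "p u \<in> L u v" if "u \<in> K" "v \<in> K" "u \<noteq> v" for u v
    using edge[OF clique[OF that]] by (auto simp: L_def)
  have L_commute: "L u v = L v u" for u v
    by (simp add: L_def insert_commute)
  interpret drawn_clique K p L
  proof
    fix u v assume uv: "u \<in> K" "v \<in> K" "u \<noteq> v"
    then have e: "arc (\<gamma> {u, v})" "{pathstart (\<gamma> {u, v}), pathfinish (\<gamma> {u, v})} = {p u, p v}"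
      using edge clique by fastforce+
    \<comment> \<open>An edge is an unordered pair, so its arc may run from \<open>v\<close> to
      \<open>u\<close> and then has to be reversed.\<close>
    consider "pathstart (\<gamma> {u, v}) = p u" "pathfinish (\<gamma> {u, v}) = p v"
      | "pathstart (\<gamma> {u, v}) = p v" "pathfinish (\<gamma> {u, v}) = p u"
      using e(2) by (auto simp: doubleton_eq_iff)
    then show "\<exists>g. arc g \<and> pathstart g = p u \<and> pathfinish g = p v \<and> path_image g = L u v"
    proof cases
      case 1
      then show ?thesis
        using e(1) by (auto simp: L_def)
    next
      case 2
      then show ?thesis
        using e(1) by (intro exI[of _ "reversepath (\<gamma> {u, v})"]) (auto simp: L_def arc_reversepath)
    qed
  next
    fix u v w assume uvw: "u \<in> K" "v \<in> K" "w \<in> K" "distinct [u, v, w]"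
    then have "L u v \<inter> p ` verts G = {p u, p v}"
      using edge[OF clique[of u v]] by (simp add: L_def)
    moreover have "p w \<in> p ` verts G" "p w \<noteq> p u" "p w \<noteq> p v"
      using uvw K(1) inj_on_eq_iff[OF inj, of w] by auto
    ultimately show "p w \<notin> L u v"
      by blast
  next
    fix u v w assume uvw: "u \<in> K" "v \<in> K" "w \<in> K" "distinct [u, v, w]"
    then have "{u, v} \<inter> {u, w} = {u}" "{u, v} \<noteq> {u, w}"
      by (auto simp: doubleton_eq_iff)
    then have "L u v \<inter> L u w \<subseteq> {p u}"
      using cross[OF clique[of u v] clique[of u w]] uvw by (auto simp: L_def)
    then show "L u v \<inter> L u w = {p u}"
      using ends uvw by auto
  next
    fix u v w x assume uvwx: "u \<in> K" "v \<in> K" "w \<in> K" "x \<in> K" "distinct [u, v, w, x]"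
    then have "{u, v} \<inter> {w, x} = {}" "{u, v} \<noteq> {w, x}"
      by auto
    then show "L u v \<inter> L w x = {}"
      using cross[OF clique[of u v] clique[of w x]] uvwx by (auto simp: L_def)
  qed (rule L_commute)
  obtain K' where "K' \<subseteq> K" "card K' = 5"
    using K(2) obtain_subset_with_card_n by metis
  moreover from this have "finite K'"
    by (simp add: card_ge_0_finite)
  ultimately obtain xs where xs: "set xs = K'" "distinct xs" "length xs = 5"
    by (metis finite_distinct_list distinct_card)
  then obtain a b c d e where "xs = [a, b, c, d, e]"
    by (auto simp: length_Suc_conv numeral_eq_Suc)
  then show False
    using no_five_vertices[of a b c d e] xs \<open>K' \<subseteq> K\<close> by auto
qed

section \<open>Straight-line drawings of disjoint small cliques\<close>

text \<open>The corners of a right triangle and its centroid. All labels from 3 on give the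
  centroid, so only labels below 4 are told apart.\<close>

definition K4_point :: "nat \<Rightarrow> complex" where
  "K4_point j = (if j = 0 then Complex 0 0 else if j = 1 then Complex 3 0
     else if j = 2 then Complex 0 3 else Complex 1 1)"

text \<open>Each of the six edges, listed once by \<open>a < b\<close>, gets the equation of its
  line and a range for one coordinate. Intersecting two edges becomes linear arithmetic.\<close>

lemma K4_segment:
  assumes "z \<in> closed_segment (K4_point a) (K4_point b)" "a < b" "b < 4"
  shows "a = 0 \<and> b = 1 \<and> Im z = 0 \<and> 0 \<le> Re z \<and> Re z \<le> 3 \<or>
    a = 0 \<and> b = 2 \<and> Re z = 0 \<and> 0 \<le> Im z \<and> Im z \<le> 3 \<or>
    a = 0 \<and> b = 3 \<and> Re z = Im z \<and> 0 \<le> Re z \<and> Re z \<le> 1 \<or>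
    a = 1 \<and> b = 2 \<and> Re z + Im z = 3 \<and> 0 \<le> Re z \<and> Re z \<le> 3 \<or>
    a = 1 \<and> b = 3 \<and> Re z + 2 * Im z = 3 \<and> 1 \<le> Re z \<and> Re z \<le> 3 \<or>
    a = 2 \<and> b = 3 \<and> 2 * Re z + Im z = 3 \<and> 0 \<le> Re z \<and> Re z \<le> 1"
proof -
  obtain t where t: "0 \<le> t" "t \<le> 1" "z = (1 - t) *\<^sub>R K4_point a + t *\<^sub>R K4_point b"
    using assms(1) by (auto simp: closed_segment_def)
  consider "a = 0" "b = 1" | "a = 0" "b = 2" | "a = 0" "b = 3" | "a = 1" "b = 2"
    | "a = 1" "b = 3" | "a = 2" "b = 3"
    using assms(2,3) by linarith
  then show ?thesis
    using t by cases (auto simp: K4_point_def)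
qed

lemma K4_segments_Int_less:
  assumes z: "z \<in> closed_segment (K4_point a) (K4_point b)" "z \<in> closed_segment (K4_point c) (K4_point d)"
    and "a < b" "b < 4" "c < d" "d < 4" "{a, b} \<noteq> {c, d}"
  shows "z \<in> K4_point ` ({a, b} \<inter> {c, d})"
  using K4_segment[OF z(1) assms(3,4)] K4_segment[OF z(2) assms(5,6)] assms(7)
  by (elim disjE conjE; simp add: K4_point_def complex_eq_iff; linarith)

lemma K4_segments_Int:
  assumes "z \<in> closed_segment (K4_point a) (K4_point b)" "z \<in> closed_segment (K4_point c) (K4_point d)"
    and "a \<noteq> b" "a < 4" "b < 4" "c \<noteq> d" "c < 4" "d < 4" "{a, b} \<noteq> {c, d}"
  shows "z \<in> K4_point ` ({a, b} \<inter> {c, d})"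
proof -
  have "z \<in> closed_segment (K4_point (min a b)) (K4_point (max a b))"
    "z \<in> closed_segment (K4_point (min c d)) (K4_point (max c d))"
    using assms(1,2) by (auto simp: min_def max_def closed_segment_commute)
  moreover have "{min a b, max a b} = {a, b}" "{min c d, max c d} = {c, d}"
    by (auto simp: min_def max_def)
  ultimately show ?thesis
    using K4_segments_Int_less[of z "min a b" "max a b" "min c d" "max c d"] assms(3-)
    by (auto simp: min_def max_def split: if_splits)
qed

lemma inj_on_K4_point: "inj_on K4_point {..<4}"
proof -
  have "{..<4} = {0, 1, 2, 3::nat}"
    by auto
  then show ?thesis
    by (auto simp: K4_point_def)
qed

text \<open>A third vertex on the edge \<open>ab\<close> would also lie on the edges
  \<open>ca\<close> and \<open>cb\<close>; by the crossing lemma it would coincide with both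
  \<open>K4_point a\<close> and \<open>K4_point b\<close>.\<close>

lemma K4_point_in_segment:
  assumes "K4_point c \<in> closed_segment (K4_point a) (K4_point b)" "a \<noteq> b" "a < 4" "b < 4" "c < 4"
  shows "c \<in> {a, b}"
proof (rule ccontr)
  assume c: "c \<notin> {a, b}"
  then have "K4_point c \<in> K4_point ` ({a, b} \<inter> {c, a})" "K4_point c \<in> K4_point ` ({a, b} \<inter> {c, b})"
    using assms by (intro K4_segments_Int; auto)+
  then show False
    using c assms inj_onD[OF inj_on_K4_point, of a b] by auto
qed

text \<open>The drawing fits into a vertical strip of width 3, so its translates by different real
  multiples of 4 are disjoint.\<close>

lemma K4_segment_bounds:
  assumes "z \<in> closed_segment (K4_point a) (K4_point b)"
  shows "0 \<le> Re z" "Re z \<le> 3"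
proof -
  obtain t where t: "0 \<le> t" "t \<le> 1" "z = (1 - t) *\<^sub>R K4_point a + t *\<^sub>R K4_point b"
    using assms by (auto simp: closed_segment_def)
  then have "Re z = (1 - t) * Re (K4_point a) + t * Re (K4_point b)"
    by simp
  moreover have "0 \<le> Re (K4_point j)" "Re (K4_point j) \<le> 3" for j
    by (auto simp: K4_point_def)
  ultimately show "0 \<le> Re z" "Re z \<le> 3"
    using t convex_bound_le[of "Re (K4_point a)" 3 "Re (K4_point b)" "1 - t" t] by auto
qed

section \<open>Planarity from straight segments and translated copies\<close>

lemma planar_straight_line:
  fixes p :: "'v \<Rightarrow> complex"
  assumes G: "simple_graph G" and inj: "inj_on p (verts G)"
    and vertex: "\<And>u v w. \<lbrakk>{u, v} \<in> edges G; w \<in> verts G; p w \<in> closed_segment (p u) (p v)\<rbrakk> \<Longrightarrow> w \<in> {u, v}"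
    and cross: "\<And>u v w x. \<lbrakk>{u, v} \<in> edges G; {w, x} \<in> edges G; {u, v} \<noteq> {w, x}\<rbrakk> \<Longrightarrow>
      closed_segment (p u) (p v) \<inter> closed_segment (p w) (p x) \<subseteq> p ` ({u, v} \<inter> {w, x})"
  shows "planar G"
proof -
  have "\<exists>u v. e = {u, v} \<and> u \<noteq> v \<and> u \<in> verts G \<and> v \<in> verts G" if "e \<in> edges G" for e
    using G that unfolding simple_graph_def by (metis card_2_iff insert_subset)
  \<comment> \<open>An arbitrary choice of direction for each edge; the assumptions on segments
    cover both orders of the ends.\<close>
  then obtain s t where st: "\<And>e. e \<in> edges G \<Longrightarrow> e = {s e, t e} \<and> s e \<noteq> t e \<and> s e \<in> verts G \<and> t e \<in> verts G"
    by metis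
  define \<gamma> where "\<gamma> e = linepath (p (s e)) (p (t e))" for e
  have "arc (\<gamma> e) \<and> {pathstart (\<gamma> e), pathfinish (\<gamma> e)} = p ` e \<and>
      path_image (\<gamma> e) \<inter> p ` verts G = p ` e" if e: "e \<in> edges G" for e
  proof (intro conjI)
    have ne: "p (s e) \<noteq> p (t e)"
      using st[OF e] inj_onD[OF inj] by blast
    have "p ` {s e, t e} = {p (s e), p (t e)}"
      by simp
    then have pe: "p ` e = {p (s e), p (t e)}"
      using st[OF e] by metis
    show "arc (\<gamma> e)"
      using ne by (simp add: \<gamma>_def arc_linepath)
    show "{pathstart (\<gamma> e), pathfinish (\<gamma> e)} = p ` e"
      by (simp add: \<gamma>_def pe)
    have "w \<in> e" if "w \<in> verts G" "p w \<in> closed_segment (p (s e)) (p (t e))" for w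
      using vertex[of "s e" "t e" w] st[OF e] e that by auto
    then show "path_image (\<gamma> e) \<inter> p ` verts G = p ` e"
      using st[OF e] pe by (auto simp: \<gamma>_def)
  qed
  moreover have "path_image (\<gamma> e) \<inter> path_image (\<gamma> f) \<subseteq> p ` (e \<inter> f)"
    if "e \<in> edges G" "f \<in> edges G" "e \<noteq> f" for e f
    using cross[of "s e" "t e" "s f" "t f"] st[OF that(1)] st[OF that(2)] that by (simp add: \<gamma>_def)
  ultimately show ?thesis
    using inj unfolding planar_def plane_drawing_def by blast
qed

text \<open>Blocks get distinct numbers \<open>i B\<close> and the vertices of a block distinct
  labels below 4. Block \<open>B\<close> is drawn on the labelled points of the \<open>K4\<close>
  drawing, shifted by \<open>4 * i B\<close>.\<close>

lemma planar_disjoint_cliques: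
  assumes "finite V" and P: "partition_on V P" and card: "\<And>B. B \<in> P \<Longrightarrow> card B \<le> 4"
  shows "planar \<lparr>verts = V, edges = {{u, v} | u v. u \<noteq> v \<and> (\<exists>B\<in>P. u \<in> B \<and> v \<in> B)}\<rparr>"
    (is "planar ?G")
proof -
  have V: "\<Union>P = V" and disj: "\<And>B C. \<lbrakk>B \<in> P; C \<in> P; B \<noteq> C\<rbrakk> \<Longrightarrow> B \<inter> C = {}"
    using partition_onD1[OF P] disjointD[OF partition_onD2[OF P]] by simp_all
  have fin: "finite B" if "B \<in> P" for B
    using V \<open>finite V\<close> that by (metis Union_upper finite_subset)
  obtain i :: "'a set \<Rightarrow> nat" where i: "inj_on i P"
    using finite_elements[OF \<open>finite V\<close> P] finite_imp_inj_to_nat_seg by metis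
  have "\<exists>j. inj_on j B \<and> j ` B \<subseteq> {..<4::nat}" if B: "B \<in> P" for B
  proof -
    obtain h where "bij_betw h B {0..<card B}"
      using ex_bij_betw_finite_nat[OF fin[OF B]] by blast
    then show ?thesis
      using card[OF B] by (intro exI[of _ h]) (auto simp: bij_betw_def)
  qed
  then obtain j :: "'a set \<Rightarrow> 'a \<Rightarrow> nat" where
      j: "\<And>B. B \<in> P \<Longrightarrow> inj_on (j B) B" "\<And>B v. \<lbrakk>B \<in> P; v \<in> B\<rbrakk> \<Longrightarrow> j B v < 4"
    by (metis image_subset_iff lessThan_iff)
  define block where "block v = (THE B. B \<in> P \<and> v \<in> B)" for v
  have block: "block v = B" if "B \<in> P" "v \<in> B" for v B
    unfolding block_def using that disj by (intro the_equality) blast+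
  define p where "p v = of_nat (4 * i (block v)) + K4_point (j (block v) v)" for v
  have p: "p v = of_nat (4 * i B) + K4_point (j B v)" if "B \<in> P" "v \<in> B" for v B
    using block[OF that] by (simp add: p_def)
  have same_block: "B = C" if "B \<in> P" "C \<in> P" "u \<in> B" "v \<in> B" "w \<in> C" "x \<in> C"
    "z \<in> closed_segment (p u) (p v)" "z \<in> closed_segment (p w) (p x)" for B C u v w x z
  proof -
    have b: "4 * real (i B) \<le> Re z \<and> Re z \<le> 4 * real (i B) + 3"
      if "B \<in> P" "u \<in> B" "v \<in> B" "z \<in> closed_segment (p u) (p v)" for B u v
    proof -
      define y where "y = z - of_nat (4 * i B)"
      have z: "z = of_nat (4 * i B) + y"
        by (simp add: y_def)
      then have "y \<in> closed_segment (K4_point (j B u)) (K4_point (j B v))"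
        using that p by (simp only: closed_segment_translation_eq)
      then have "0 \<le> Re y" "Re y \<le> 3"
        by (rule K4_segment_bounds)+
      then show ?thesis
        by (simp add: z)
    qed
    \<comment> \<open>Both \<open>4 * i B\<close> and \<open>4 * i C\<close> lie between
      \<open>Re z - 3\<close> and \<open>Re z\<close>, where there is at most one multiple of
      4.\<close>
    have "i B = i C"
      using b[OF that(1,3,4,7)] b[OF that(2,5,6,8)] by linarith
    then show ?thesis
      using inj_onD[OF i] that(1,2) by blast
  qed
  have label: "j B u = j B v \<longleftrightarrow> u = v" if "B \<in> P" "u \<in> B" "v \<in> B" for B u v
    using inj_on_eq_iff[OF j(1)] that by blast
  have simple: "simple_graph ?G"
    using \<open>finite V\<close> V by (auto simp: simple_graph_def)
  have edge: "\<exists>B\<in>P. u \<in> B \<and> v \<in> B \<and> u \<noteq> v" if "{u, v} \<in> edges ?G" for u v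
    using that by (auto simp: doubleton_eq_iff)
  have inj: "inj_on p (verts ?G)"
  proof (rule inj_onI)
    fix u v assume uv: "u \<in> verts ?G" "v \<in> verts ?G" "p u = p v"
    then obtain B C where BC: "B \<in> P" "u \<in> B" "C \<in> P" "v \<in> C"
      using V by auto
    \<comment> \<open>A vertex is treated as the degenerate segment from \<open>p u\<close> to
      \<open>p u\<close>, so separating segments also separates vertices.\<close>
    then have "B = C"
      using uv(3) by (intro same_block[of B C u u v v "p u"]) auto
    then have "K4_point (j B u) = K4_point (j B v)"
      using BC uv(3) p[of B u] p[of B v] by simp
    then have "j B u = j B v"
      using BC \<open>B = C\<close> j(2) inj_onD[OF inj_on_K4_point, of "j B u" "j B v"] by simp
    then show "u = v"
      using BC \<open>B = C\<close> label by simp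
  qed
  have vertex: "w \<in> {u, v}" if h: "{u, v} \<in> edges ?G" "w \<in> verts ?G" "p w \<in> closed_segment (p u) (p v)" for u v w
  proof -
    obtain B where B: "B \<in> P" "u \<in> B" "v \<in> B" "u \<noteq> v"
      using edge[OF h(1)] by blast
    obtain C where C: "C \<in> P" "w \<in> C"
      using h(2) V by auto
    have "B = C"
      using B C h(3) by (intro same_block[of B C u v w w "p w"]) auto
    then have "K4_point (j B w) \<in> closed_segment (K4_point (j B u)) (K4_point (j B v))"
      using h(3) C unfolding \<open>B = C\<close>[symmetric]
      by (simp only: p[OF B(1)] B closed_segment_translation_eq)
    then have "j B w \<in> {j B u, j B v}"
      using B C \<open>B = C\<close> j(2) label[of B u v] by (intro K4_point_in_segment) auto
    then show ?thesis
      using B C \<open>B = C\<close> label[of B w] by auto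
  qed
  have cross: "closed_segment (p u) (p v) \<inter> closed_segment (p w) (p x) \<subseteq> p ` ({u, v} \<inter> {w, x})"
    if h: "{u, v} \<in> edges ?G" "{w, x} \<in> edges ?G" "{u, v} \<noteq> {w, x}" for u v w x
  proof
    fix z assume z: "z \<in> closed_segment (p u) (p v) \<inter> closed_segment (p w) (p x)"
    obtain B where B: "B \<in> P" "u \<in> B" "v \<in> B" "u \<noteq> v"
      using edge[OF h(1)] by blast
    obtain C where C: "C \<in> P" "w \<in> C" "x \<in> C" "w \<noteq> x"
      using edge[OF h(2)] by blast
    have "B = C"
      using B C z by (intro same_block[of B C u v w x z]) auto
    define y where "y = z - of_nat (4 * i B)"
    have zy: "z = of_nat (4 * i B) + y"
      by (simp add: y_def)
    have y: "y \<in> closed_segment (K4_point (j B u)) (K4_point (j B v))"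
        "y \<in> closed_segment (K4_point (j B w)) (K4_point (j B x))"
      using z p B C \<open>B = C\<close> unfolding zy by (simp_all only: closed_segment_translation_eq Int_iff)
    have img: "{j B u, j B v} = j B ` {u, v}" "{j B w, j B x} = j B ` {w, x}"
      by auto
    have sub: "{u, v} \<subseteq> B" "{w, x} \<subseteq> B"
      using B C \<open>B = C\<close> by auto
    \<comment> \<open>Labels are injective on the common block, so distinct edges have distinct
      label pairs, and a shared label comes from a shared vertex.\<close>
    have "j B ` {u, v} \<noteq> j B ` {w, x}"
      using inj_on_image_eq_iff[OF j(1) sub] B h(3) by blast
    then have "y \<in> K4_point ` ({j B u, j B v} \<inter> {j B w, j B x})"
      using y B C \<open>B = C\<close> j(2) label[of B u v] label[of B w x] img by (intro K4_segments_Int) auto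
    also have "{j B u, j B v} \<inter> {j B w, j B x} = j B ` ({u, v} \<inter> {w, x})"
      unfolding img using inj_on_image_Int[OF j(1) sub] B by simp
    finally obtain a where a: "a \<in> {u, v} \<inter> {w, x}" "y = K4_point (j B a)"
      by auto
    then have "z = p a"
      using p[of B a] sub B zy by auto
    then show "z \<in> p ` ({u, v} \<inter> {w, x})"
      using a by blast
  qed
  show ?thesis
    using planar_straight_line[OF simple inj vertex cross] .
qed

section \<open>Group-connected and fully-connected architectures\<close>

lemma grouping_blocks:
  assumes "grouping NG groups" "N > 0" "NG dvd N"
  shows "partition_on {1..N} (groups N)" "\<And>B. B \<in> groups N \<Longrightarrow> card B = NG"
  using assms unfolding grouping_def by blast+

theorem proposition2:
  fixes NG :: nat
  assumes "NG \<ge> 1"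
  shows "(\<forall>groups. grouping NG groups \<longrightarrow> (planar_connected (group_connected NG groups) \<longleftrightarrow> NG \<le> 4))
         \<and> \<not> planar_connected fully_connected"
proof (intro conjI allI impI iffI)
  fix groups assume groups: "grouping NG groups" and planar: "planar_connected (group_connected NG groups)"
  show "NG \<le> 4"
  proof (rule ccontr)
    assume "\<not> NG \<le> 4"
    \<comment> \<open>The least admissible size \<open>N = NG\<close> is chosen: by cardinality a
      group is then all of \<open>{1..NG}\<close>, a clique on \<open>NG\<close> vertices.\<close>
    have part: "partition_on {1..NG} (groups NG)" and card: "\<And>B. B \<in> groups NG \<Longrightarrow> card B = NG"
      using grouping_blocks[OF groups, of NG] assms by simp_all
    have "1 \<in> \<Union>(groups NG)"
      using partition_onD1[OF part, symmetric] assms by simp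
    then obtain B where B: "B \<in> groups NG"
      by blast
    then have "B \<subseteq> {1..NG}"
      using partition_onD1[OF part] by blast
    then have "B = {1..NG}"
      using card[OF B] by (intro card_subset_eq) auto
    define G where "G = \<lparr>verts = {1..NG},
      edges = {{u, v} | u v. u \<noteq> v \<and> (\<exists>B\<in>groups NG. u \<in> B \<and> v \<in> B)}\<rparr>"
    have "group_connected NG groups NG = Some G"
      using assms by (simp add: group_connected_def G_def)
    then have "planar G"
      using planar by (auto simp: planar_connected_def)
    moreover have "\<not> planar G"
    proof (rule not_planar_if_clique5)
      show "B \<subseteq> verts G" "card B \<ge> 5"
        using \<open>B = {1..NG}\<close> \<open>\<not> NG \<le> 4\<close> by (simp_all add: G_def)
      show "{u, v} \<in> edges G" if "u \<in> B" "v \<in> B" "u \<noteq> v" for u v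
        using that B by (auto simp: G_def)
    qed
    ultimately show False
      by blast
  qed
next
  fix groups assume groups: "grouping NG groups" and "NG \<le> 4"
  show "planar_connected (group_connected NG groups)"
    unfolding planar_connected_def
  proof (intro allI impI)
    fix N G assume "group_connected NG groups N = Some G"
    then have N: "N > 0" "NG dvd N"
      and G: "G = \<lparr>verts = {1..N}, edges = {{u, v} | u v. u \<noteq> v \<and> (\<exists>B\<in>groups N. u \<in> B \<and> v \<in> B)}\<rparr>"
      by (auto simp: group_connected_def split: if_splits)
    show "planar G"
      unfolding G using grouping_blocks[OF groups N] \<open>NG \<le> 4\<close>
      by (intro planar_disjoint_cliques) simp_all
  qed
next
  \<comment> \<open>One admissible size with a nonplanar graph suffices, and size 5 gives
    \<open>K5\<close> itself.\<close>
  have "\<not> planar (complete_graph {1..5::nat})"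
    by (rule not_planar_if_clique5[of "{1..5}"]) (auto simp: complete_graph_def)
  moreover have "fully_connected 5 = Some (complete_graph {1..5})"
    by (simp add: fully_connected_def)
  ultimately show "\<not> planar_connected fully_connected"
    unfolding planar_connected_def by blast
qed

end
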